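(* Let $f: X \to Y$ be a continuous mapping of topological spaces, $y\in Y$, and let $\varphi_{n}: X\to\mathbb{R}$, $n \in \mathbb{N}$, be a family of (bounded) functions that are $f$-continuous at $y$ and such that the series $\sum_{n=1}^{\infty}\|\varphi_{n}\|$ converges. Then the function $\varphi (x) = \sum_{n=1}^{\infty}\varphi_{n}(x)$ is $f$-continuous at $y$.
   Context: Neighborhoods are open; functions are real-valued and not necessarily continuous. For a bounded function $\varphi:X\to\mathbb R$, $\|\varphi\|=\sup_{x\in X}|\varphi(x)|$. For a bounded $\varphi:X\to\mathbb R$ and $x\in X$, $\mathrm{osc}_\varphi(x)=\inf\{\sup_{z\in U}|\varphi(x)-\varphi(z)| : U \text{ an open neighborhood of } x\}$; for non-empty $A\subset X$, $\mathrm{osc}_\varphi(A)=\sup_{x\in A}\mathrm{osc}_\varphi(x)$, and $\mathrm{osc}_\varphi(\varnothing)=0$. A bounded function $\varphi: X\to\mathbb R$ is $f$-continuous at $y\in Y$ if for any $\varepsilon>0$ there is a neighborhood $\mathcal{O}y$ of $y$ with $\mathrm{osc}_\varphi(f^{-1}\mathcal{O}y)<\varepsilon$. *)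

theory Defs
  imports "HOL-Analysis.Analysis"
begin

text \<open>Spaces are abstract topologies, so the empty space is included. Real-valued functions on
  \<open>X\<close> are total functions on the carrier type of which only the values on \<open>topspace X\<close> are used.
  The real suprema and infima below are intended for functions bounded on \<open>topspace X\<close> and, for
  \<open>osc_at\<close> and \<open>osc_on\<close>, points and subsets of \<open>topspace X\<close>.\<close>

definition bounded_fun :: "'a topology \<Rightarrow> ('a \<Rightarrow> real) \<Rightarrow> bool" where
  "bounded_fun X \<phi> \<longleftrightarrow> bounded (\<phi> ` topspace X)"

text \<open>The empty case is separated because \<open>Sup {}\<close> is unspecified for reals.\<close>

definition sup_norm :: "'a topology \<Rightarrow> ('a \<Rightarrow> real) \<Rightarrow> real" where
  "sup_norm X \<phi> = (if topspace X = {} then 0 else (SUP x\<in>topspace X. \<bar>\<phi> x\<bar>))"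

definition osc_at :: "'a topology \<Rightarrow> ('a \<Rightarrow> real) \<Rightarrow> 'a \<Rightarrow> real" where
  "osc_at X \<phi> x = (INF U\<in>{U. openin X U \<and> x \<in> U}. SUP z\<in>U. \<bar>\<phi> x - \<phi> z\<bar>)"

definition osc_on :: "'a topology \<Rightarrow> ('a \<Rightarrow> real) \<Rightarrow> 'a set \<Rightarrow> real" where
  "osc_on X \<phi> A = (if A = {} then 0 else (SUP x\<in>A. osc_at X \<phi> x))"

definition f_continuous_at ::
  "'a topology \<Rightarrow> 'b topology \<Rightarrow> ('a \<Rightarrow> 'b) \<Rightarrow> ('a \<Rightarrow> real) \<Rightarrow> 'b \<Rightarrow> bool" where
  "f_continuous_at X Y f \<phi> y \<longleftrightarrow>
     bounded_fun X \<phi> \<and>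
     (\<forall>\<epsilon>>0. \<exists>V. openin Y V \<and> y \<in> V \<and> osc_on X \<phi> {x \<in> topspace X. f x \<in> V} < \<epsilon>)"

end

theory Submission
  imports Defs
begin

text \<open>The statement is the analogue for \<open>f\<close>-continuity of the theorem that a uniformly convergent
  series of functions continuous at a point has a sum continuous at that point. The oscillation
  of a bounded function at \<open>x\<close> is small exactly when \<open>\<phi>\<close> varies little on some neighbourhood of
  \<open>x\<close>, so \<open>f\<close>-continuity at \<open>y\<close> turns into an \<open>\<epsilon>\<close>-condition without suprema and infima
  (\<open>f_continuous_at_iff\<close>): every \<open>\<epsilon>\<close> has a neighbourhood \<open>V\<close> of \<open>y\<close> such that each point \<open>x\<close> of
  the preimage of \<open>V\<close> has a neighbourhood on which \<open>\<phi>\<close> stays \<open>\<epsilon>\<close>-close to \<open>\<phi> x\<close>. In this form the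
  usual arguments apply: finite sums are handled by intersecting neighbourhoods
  (\<open>f_continuous_at_sum\<close>), and uniform limits by a three-term estimate
  (\<open>f_continuous_at_uniform_limit\<close>). Finally, since \<open>\<bar>\<phi>\<^sub>n x\<bar> \<le> \<parallel>\<phi>\<^sub>n\<parallel>\<close>, the Weierstrass test says
  that the partial sums converge uniformly.\<close>

lemma abs_le_sup_norm:
  assumes "bounded_fun X \<phi>" "x \<in> topspace X"
  shows "\<bar>\<phi> x\<bar> \<le> sup_norm X \<phi>"
proof -
  have "bdd_above ((\<lambda>x. \<bar>\<phi> x\<bar>) ` topspace X)"
    using assms(1) by (auto simp: bounded_fun_def bounded_iff bdd_above_def)
  then show ?thesis
    using assms(2) by (auto simp: sup_norm_def intro: cSUP_upper)
qed

lemma bdd_above_variation: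
  assumes "bounded_fun X \<phi>" "U \<subseteq> topspace X"
  shows "bdd_above ((\<lambda>z. \<bar>c - \<phi> z\<bar>) ` U)"
proof -
  obtain B where B: "\<And>z. z \<in> topspace X \<Longrightarrow> \<bar>\<phi> z\<bar> \<le> B"
    using assms(1) by (auto simp: bounded_fun_def bounded_iff)
  show ?thesis
  proof (rule bdd_aboveI2)
    fix z assume "z \<in> U"
    then show "\<bar>c - \<phi> z\<bar> \<le> \<bar>c\<bar> + B"
      using B[of z] assms(2) by fastforce
  qed
qed

lemma osc_at_le:
  assumes "bounded_fun X \<phi>" "openin X U" "x \<in> U" "\<And>z. z \<in> U \<Longrightarrow> \<bar>\<phi> x - \<phi> z\<bar> \<le> e"
  shows "osc_at X \<phi> x \<le> e"
proof -
  have "bdd_below ((\<lambda>U. SUP z\<in>U. \<bar>\<phi> x - \<phi> z\<bar>) ` {U. openin X U \<and> x \<in> U})"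
  proof (rule bdd_belowI2)
    fix U assume U: "U \<in> {U. openin X U \<and> x \<in> U}"
    then have "bdd_above ((\<lambda>z. \<bar>\<phi> x - \<phi> z\<bar>) ` U)"
      using bdd_above_variation[OF assms(1)] openin_subset[of X U] by simp
    then have "\<bar>\<phi> x - \<phi> x\<bar> \<le> (SUP z\<in>U. \<bar>\<phi> x - \<phi> z\<bar>)"
      using U by (intro cSUP_upper) auto
    then show "0 \<le> (SUP z\<in>U. \<bar>\<phi> x - \<phi> z\<bar>)" by simp
  qed
  then have "osc_at X \<phi> x \<le> (SUP z\<in>U. \<bar>\<phi> x - \<phi> z\<bar>)"
    unfolding osc_at_def using assms(2,3) by (intro cINF_lower) auto
  also have "\<dots> \<le> e"
    using assms(3,4) by (intro cSUP_least) auto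
  finally show ?thesis .
qed

lemma osc_at_lessD:
  assumes "bounded_fun X \<phi>" "x \<in> topspace X" "osc_at X \<phi> x < e"
  obtains U where "openin X U" "x \<in> U" "\<And>z. z \<in> U \<Longrightarrow> \<bar>\<phi> x - \<phi> z\<bar> < e"
proof -
  have "{U. openin X U \<and> x \<in> U} \<noteq> {}"
    using assms(2) by blast
  then obtain U where U: "openin X U" "x \<in> U" and less: "(SUP z\<in>U. \<bar>\<phi> x - \<phi> z\<bar>) < e"
    using cInf_lessD[of "(\<lambda>U. SUP z\<in>U. \<bar>\<phi> x - \<phi> z\<bar>) ` {U. openin X U \<and> x \<in> U}" e] assms(3)
    unfolding osc_at_def by auto
  have "\<bar>\<phi> x - \<phi> z\<bar> < e" if "z \<in> U" for z
    using cSUP_upper[OF that bdd_above_variation[OF assms(1) openin_subset[OF U(1)]], of "\<phi> x"]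
      less by linarith
  with U that show ?thesis by blast
qed

text \<open>A real supremum bounds its members only if the set is bounded above, which here comes from
  \<open>\<phi>\<close> being bounded: all oscillations are at most \<open>2 * B\<close>.\<close>

lemma osc_at_le_osc_on:
  assumes "bounded_fun X \<phi>" "A \<subseteq> topspace X" "x \<in> A"
  shows "osc_at X \<phi> x \<le> osc_on X \<phi> A"
proof -
  obtain B where B: "\<And>z. z \<in> topspace X \<Longrightarrow> \<bar>\<phi> z\<bar> \<le> B"
    using assms(1) by (auto simp: bounded_fun_def bounded_iff)
  have "bdd_above (osc_at X \<phi> ` A)"
  proof (rule bdd_aboveI2)
    fix x assume "x \<in> A"
    then have x: "x \<in> topspace X"
      using assms(2) by blast
    show "osc_at X \<phi> x \<le> 2 * B"
    proof (rule osc_at_le[OF assms(1) openin_topspace x])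
      fix z assume "z \<in> topspace X"
      then show "\<bar>\<phi> x - \<phi> z\<bar> \<le> 2 * B"
        using B[OF x] B[of z] by linarith
    qed
  qed
  then show ?thesis
    using assms(3) by (auto simp: osc_on_def intro: cSUP_upper)
qed

lemma osc_on_le:
  assumes "0 \<le> e" "\<And>x. x \<in> A \<Longrightarrow> osc_at X \<phi> x \<le> e"
  shows "osc_on X \<phi> A \<le> e"
  unfolding osc_on_def using assms by (simp add: cSUP_least)

text \<open>Oscillations appear in \<open>f_continuous_at\<close> only through being arbitrarily small, so the
  suprema and infima can be traded for pointwise estimates. In the direction from right to left
  the pointwise bound survives the suprema only as a weak inequality, which is why that direction
  starts from \<open>\<epsilon> / 2\<close>.\<close>

lemma f_continuous_at_iff:
  "f_continuous_at X Y f \<phi> y \<longleftrightarrow>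
     bounded_fun X \<phi> \<and>
     (\<forall>\<epsilon>>0. \<exists>V. openin Y V \<and> y \<in> V \<and>
        (\<forall>x\<in>topspace X. f x \<in> V \<longrightarrow>
           (\<exists>U. openin X U \<and> x \<in> U \<and> (\<forall>z\<in>U. \<bar>\<phi> x - \<phi> z\<bar> < \<epsilon>))))"
    (is "_ \<longleftrightarrow> _ \<and> (\<forall>\<epsilon>>0. \<exists>V. _ \<and> _ \<and> ?close V \<epsilon>)")
proof (cases "bounded_fun X \<phi>")
  case bdd: True
  have close: "?close V \<epsilon>" if less: "osc_on X \<phi> {x \<in> topspace X. f x \<in> V} < \<epsilon>" for V \<epsilon>
  proof (intro ballI impI)
    fix x assume x: "x \<in> topspace X" "f x \<in> V"
    then have "osc_at X \<phi> x < \<epsilon>"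
      using osc_at_le_osc_on[OF bdd, of "{x \<in> topspace X. f x \<in> V}" x] less by auto
    then show "\<exists>U. openin X U \<and> x \<in> U \<and> (\<forall>z\<in>U. \<bar>\<phi> x - \<phi> z\<bar> < \<epsilon>)"
      using osc_at_lessD[OF bdd x(1)] by metis
  qed
  have small: "osc_on X \<phi> {x \<in> topspace X. f x \<in> V} < \<epsilon>" if "\<epsilon> > 0" "?close V (\<epsilon> / 2)" for V \<epsilon>
  proof -
    have "osc_at X \<phi> x \<le> \<epsilon> / 2" if x: "x \<in> topspace X" "f x \<in> V" for x
      using \<open>?close V (\<epsilon> / 2)\<close> x osc_at_le[OF bdd] by (meson less_imp_le)
    then have "osc_on X \<phi> {x \<in> topspace X. f x \<in> V} \<le> \<epsilon> / 2"
      using \<open>\<epsilon> > 0\<close> by (intro osc_on_le) auto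
    with \<open>\<epsilon> > 0\<close> show ?thesis by linarith
  qed
  show ?thesis
  proof
    assume "f_continuous_at X Y f \<phi> y"
    then show "bounded_fun X \<phi> \<and> (\<forall>\<epsilon>>0. \<exists>V. openin Y V \<and> y \<in> V \<and> ?close V \<epsilon>)"
      unfolding f_continuous_at_def using close by meson
  next
    assume R: "bounded_fun X \<phi> \<and> (\<forall>\<epsilon>>0. \<exists>V. openin Y V \<and> y \<in> V \<and> ?close V \<epsilon>)"
    have "\<exists>V. openin Y V \<and> y \<in> V \<and> osc_on X \<phi> {x \<in> topspace X. f x \<in> V} < \<epsilon>"
      if \<epsilon>: "\<epsilon> > 0" for \<epsilon>
    proof -
      obtain V where "openin Y V" "y \<in> V" "?close V (\<epsilon> / 2)"
        using R half_gt_zero[OF \<epsilon>] by blast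
      with small[OF \<epsilon>] show ?thesis by blast
    qed
    with bdd show "f_continuous_at X Y f \<phi> y"
      unfolding f_continuous_at_def by blast
  qed
next
  case False
  then show ?thesis by (simp add: f_continuous_at_def)
qed

lemma f_continuous_atE:
  assumes "f_continuous_at X Y f \<phi> y" "\<epsilon> > 0"
  obtains V where "openin Y V" "y \<in> V"
    "\<forall>x\<in>topspace X. f x \<in> V \<longrightarrow>
       (\<exists>U. openin X U \<and> x \<in> U \<and> (\<forall>z\<in>U. \<bar>\<phi> x - \<phi> z\<bar> < \<epsilon>))"
  using assms(1)[unfolded f_continuous_at_iff, THEN conjunct2, THEN spec, THEN mp, OF assms(2)]
  by (elim exE conjE) (rule that)

lemma f_continuous_at_const:
  assumes "y \<in> topspace Y"
  shows "f_continuous_at X Y f (\<lambda>x. c) y"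
proof -
  have "bounded_fun X (\<lambda>x. c)"
    by (auto simp: bounded_fun_def bounded_iff)
  then show ?thesis
    unfolding f_continuous_at_iff using assms by auto
qed

lemma f_continuous_at_add:
  assumes \<phi>: "f_continuous_at X Y f \<phi> y" and \<psi>: "f_continuous_at X Y f \<psi> y"
  shows "f_continuous_at X Y f (\<lambda>x. \<phi> x + \<psi> x) y"
  unfolding f_continuous_at_iff
proof (intro conjI allI impI)
  show "bounded_fun X (\<lambda>x. \<phi> x + \<psi> x)"
    using \<phi> \<psi> by (auto simp: f_continuous_at_def bounded_fun_def intro: bounded_plus_comp)
next
  fix \<epsilon> :: real
  assume "\<epsilon> > 0"
  then have half: "\<epsilon> / 2 > 0" by simp
  obtain V where V: "openin Y V" "y \<in> V"
    and V_close: "\<forall>x\<in>topspace X. f x \<in> V \<longrightarrow>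
      (\<exists>U. openin X U \<and> x \<in> U \<and> (\<forall>z\<in>U. \<bar>\<phi> x - \<phi> z\<bar> < \<epsilon> / 2))"
    using \<phi> half by (rule f_continuous_atE)
  obtain W where W: "openin Y W" "y \<in> W"
    and W_close: "\<forall>x\<in>topspace X. f x \<in> W \<longrightarrow>
      (\<exists>U. openin X U \<and> x \<in> U \<and> (\<forall>z\<in>U. \<bar>\<psi> x - \<psi> z\<bar> < \<epsilon> / 2))"
    using \<psi> half by (rule f_continuous_atE)
  have close: "\<exists>U. openin X U \<and> x \<in> U \<and> (\<forall>z\<in>U. \<bar>(\<phi> x + \<psi> x) - (\<phi> z + \<psi> z)\<bar> < \<epsilon>)"
    if x: "x \<in> topspace X" "f x \<in> V \<inter> W" for x
  proof -
    have fx: "f x \<in> V" "f x \<in> W"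
      using x(2) by simp_all
    obtain U1 where U1: "openin X U1" "x \<in> U1" "\<forall>z\<in>U1. \<bar>\<phi> x - \<phi> z\<bar> < \<epsilon> / 2"
      using V_close[THEN bspec, THEN mp, OF x(1) fx(1)] by (elim exE conjE) (rule that)
    obtain U2 where U2: "openin X U2" "x \<in> U2" "\<forall>z\<in>U2. \<bar>\<psi> x - \<psi> z\<bar> < \<epsilon> / 2"
      using W_close[THEN bspec, THEN mp, OF x(1) fx(2)] by (elim exE conjE) (rule that)
    have near: "\<bar>(\<phi> x + \<psi> x) - (\<phi> z + \<psi> z)\<bar> < \<epsilon>" if "z \<in> U1 \<inter> U2" for z
    proof -
      have "\<bar>\<phi> x - \<phi> z\<bar> < \<epsilon> / 2" "\<bar>\<psi> x - \<psi> z\<bar> < \<epsilon> / 2"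
        using U1(3) U2(3) that by simp_all
      then show ?thesis by linarith
    qed
    show ?thesis
      by (intro exI[of _ "U1 \<inter> U2"] conjI openin_Int IntI ballI U1(1,2) U2(1,2) near) auto
  qed
  show "\<exists>V. openin Y V \<and> y \<in> V \<and> (\<forall>x\<in>topspace X. f x \<in> V \<longrightarrow>
      (\<exists>U. openin X U \<and> x \<in> U \<and> (\<forall>z\<in>U. \<bar>\<phi> x + \<psi> x - (\<phi> z + \<psi> z)\<bar> < \<epsilon>)))"
    by (intro exI[of _ "V \<inter> W"] conjI openin_Int IntI V W ballI impI close) auto
qed

lemma f_continuous_at_sum:
  assumes "y \<in> topspace Y" "\<And>i. i \<in> I \<Longrightarrow> f_continuous_at X Y f (\<phi> i) y"
  shows "f_continuous_at X Y f (\<lambda>x. \<Sum>i\<in>I. \<phi> i x) y"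
  using assms(2)
proof (induction I rule: infinite_finite_induct)
  case (insert i I)
  then show ?case by (simp add: f_continuous_at_add)
qed (simp_all add: f_continuous_at_const assms(1))

text \<open>The three terms of the estimate are the two errors of approximation, at \<open>x\<close> and at a nearby
  point, and the variation of the approximating function between these points.\<close>

lemma f_continuous_at_uniform_limit:
  assumes lim: "uniform_limit (topspace X) \<psi> \<phi> F" and "F \<noteq> bot"
    and cont: "eventually (\<lambda>n. f_continuous_at X Y f (\<psi> n) y) F"
  shows "f_continuous_at X Y f \<phi> y"
proof -
  have approx: "\<exists>g. f_continuous_at X Y f g y \<and> (\<forall>x\<in>topspace X. \<bar>g x - \<phi> x\<bar> < e)"
    if "e > 0" for e
  proof -
    have "eventually (\<lambda>n. \<forall>x\<in>topspace X. \<bar>\<psi> n x - \<phi> x\<bar> < e) F"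
      using uniform_limitD[OF lim that] by (simp add: dist_real_def)
    with cont have "eventually (\<lambda>n. f_continuous_at X Y f (\<psi> n) y \<and>
        (\<forall>x\<in>topspace X. \<bar>\<psi> n x - \<phi> x\<bar> < e)) F"
      by (rule eventually_conj)
    then show ?thesis
      using eventually_happens'[OF \<open>F \<noteq> bot\<close>] by blast
  qed
  show ?thesis
    unfolding f_continuous_at_iff
  proof (intro conjI allI impI)
    obtain g where g: "f_continuous_at X Y f g y" "\<And>x. x \<in> topspace X \<Longrightarrow> \<bar>g x - \<phi> x\<bar> < 1"
      using approx[of 1] by auto
    obtain B where B: "\<And>x. x \<in> topspace X \<Longrightarrow> \<bar>g x\<bar> \<le> B"
      using g(1) by (auto simp: f_continuous_at_def bounded_fun_def bounded_iff)
    have "\<bar>\<phi> x\<bar> \<le> B + 1" if "x \<in> topspace X" for x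
      using B[OF that] g(2)[OF that] by linarith
    then show "bounded_fun X \<phi>"
      by (auto simp: bounded_fun_def bounded_iff)
  next
    fix \<epsilon> :: real
    assume "\<epsilon> > 0"
    then have third: "\<epsilon> / 3 > 0" by simp
    obtain g where g: "f_continuous_at X Y f g y" "\<And>x. x \<in> topspace X \<Longrightarrow> \<bar>g x - \<phi> x\<bar> < \<epsilon> / 3"
      using approx[OF third] by auto
    obtain V where V: "openin Y V" "y \<in> V"
      and V_close: "\<forall>x\<in>topspace X. f x \<in> V \<longrightarrow>
        (\<exists>U. openin X U \<and> x \<in> U \<and> (\<forall>z\<in>U. \<bar>g x - g z\<bar> < \<epsilon> / 3))"
      using g(1) third by (rule f_continuous_atE)
    have close: "\<exists>U. openin X U \<and> x \<in> U \<and> (\<forall>z\<in>U. \<bar>\<phi> x - \<phi> z\<bar> < \<epsilon>)"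
      if x: "x \<in> topspace X" "f x \<in> V" for x
    proof -
      obtain U where U: "openin X U" "x \<in> U" "\<forall>z\<in>U. \<bar>g x - g z\<bar> < \<epsilon> / 3"
        using V_close[THEN bspec, THEN mp, OF x] by (elim exE conjE) (rule that)
      have "\<bar>\<phi> x - \<phi> z\<bar> < \<epsilon>" if "z \<in> U" for z
      proof -
        have "z \<in> topspace X"
          using openin_subset[OF U(1)] that by blast
        then show ?thesis
          using g(2)[OF x(1)] g(2)[of z] bspec[OF U(3) that] by linarith
      qed
      with U(1,2) show ?thesis by blast
    qed
    show "\<exists>V. openin Y V \<and> y \<in> V \<and> (\<forall>x\<in>topspace X. f x \<in> V \<longrightarrow>
        (\<exists>U. openin X U \<and> x \<in> U \<and> (\<forall>z\<in>U. \<bar>\<phi> x - \<phi> z\<bar> < \<epsilon>)))"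
      by (intro exI[of _ V] conjI V ballI impI close)
  qed
qed

theorem lemma2p4:
  fixes X :: "'a topology" and Y :: "'b topology"
    and f :: "'a \<Rightarrow> 'b" and y :: 'b and \<phi> :: "nat \<Rightarrow> 'a \<Rightarrow> real"
  assumes "continuous_map X Y f"
    and "y \<in> topspace Y"
    and "\<And>n. n \<ge> 1 \<Longrightarrow> f_continuous_at X Y f (\<phi> n) y"
    and "summable (\<lambda>n. sup_norm X (\<phi> (Suc n)))"
  shows "(\<forall>x\<in>topspace X. summable (\<lambda>n. \<phi> (Suc n) x)) \<and>
         f_continuous_at X Y f (\<lambda>x. \<Sum>n. \<phi> (Suc n) x) y"
proof
  have cont: "f_continuous_at X Y f (\<phi> (Suc n)) y" for n
    using assms(3) by simp
  then have le: "norm (\<phi> (Suc n) x) \<le> sup_norm X (\<phi> (Suc n))" if "x \<in> topspace X" for n x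
    using abs_le_sup_norm that by (force simp: f_continuous_at_def)
  show "\<forall>x\<in>topspace X. summable (\<lambda>n. \<phi> (Suc n) x)"
    by (intro ballI summable_comparison_test'[OF assms(4)]) (rule le)
  have "uniform_limit (topspace X) (\<lambda>n x. \<Sum>i<n. \<phi> (Suc i) x) (\<lambda>x. \<Sum>n. \<phi> (Suc n) x) sequentially"
    using le assms(4) by (rule Weierstrass_m_test)
  then show "f_continuous_at X Y f (\<lambda>x. \<Sum>n. \<phi> (Suc n) x) y"
    by (rule f_continuous_at_uniform_limit)
      (simp_all add: f_continuous_at_sum[OF assms(2)] cont)
qed

end
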